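(* The isomorphism relation on countable vertex-transitive partial orders is Borel complete. That is, for every countable relational language $L$ there is a Borel function $f$ from $\mathrm{Mod}(L)$ into the standard Borel space of binary relations on $\mathbb{N}$ such that for every $A\in\mathrm{Mod}(L)$, $f(A)$ is a (strict) partial order on $\mathbb{N}$ which is vertex-transitive, and for all $A,B\in\mathrm{Mod}(L)$ we have $A\cong B$ if and only if $f(A)\cong f(B)$.
   Context: A structure is vertex-transitive if its automorphism group acts transitively on its underlying set. For a countable relational language $L$, $\mathrm{Mod}(L)$ is the standard Borel space of $L$-structures with universe $\mathbb{N}$. An equivalence relation $E$ is Borel complete if for every countable relational language $L$, isomorphism on $\mathrm{Mod}(L)$ is Borel reducible to $E$ via a Borel map $f$ with $A\cong B\iff f(A)\mathrel{E}f(B)$. *)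

theory Defs
  imports "HOL-Analysis.Analysis"
begin

text \<open>
  A relational language is a set \<open>L\<close> of relation symbols with an arity function \<open>ar\<close>; arity 0 is
  allowed. A structure with universe \<open>\<nat>\<close> assigns to each \<open>r \<in> L\<close> a predicate on the tuples
  (lists) of length \<open>ar r\<close>. The product sigma-algebra below is the Borel sigma-algebra of the product
  topology on \<open>\<Prod>r\<in>L. 2^(\<nat>^(ar r))\<close>, since for countable \<open>L\<close> there are only countably many
  discrete two-point factors. Its points are extensional: they are \<open>undefined\<close> outside \<open>L\<close> and
  on lists of the wrong length.
\<close>

definition Mod_space :: "'r set \<Rightarrow> ('r \<Rightarrow> nat) \<Rightarrow> ('r \<Rightarrow> nat list \<Rightarrow> bool) measure" where
  "Mod_space L ar =
     (\<Pi>\<^sub>M r\<in>L. \<Pi>\<^sub>M xs\<in>{xs. length xs = ar r}. count_space UNIV)"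

definition structure_iso ::
    "'r set \<Rightarrow> ('r \<Rightarrow> nat) \<Rightarrow> ('r \<Rightarrow> nat list \<Rightarrow> bool) \<Rightarrow> ('r \<Rightarrow> nat list \<Rightarrow> bool) \<Rightarrow> bool" where
  "structure_iso L ar A B \<longleftrightarrow>
     (\<exists>p. bij p \<and> (\<forall>r\<in>L. \<forall>xs. length xs = ar r \<longrightarrow> (A r xs \<longleftrightarrow> B r (map p xs))))"

definition binrel_space :: "(nat \<Rightarrow> nat \<Rightarrow> bool) measure" where
  "binrel_space = (\<Pi>\<^sub>M x\<in>UNIV. \<Pi>\<^sub>M y\<in>UNIV. count_space UNIV)"

definition rel_isomorphism :: "('a \<Rightarrow> 'a \<Rightarrow> bool) \<Rightarrow> ('b \<Rightarrow> 'b \<Rightarrow> bool) \<Rightarrow> ('a \<Rightarrow> 'b) \<Rightarrow> bool" where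
  "rel_isomorphism R S p \<longleftrightarrow> bij p \<and> (\<forall>x y. R x y \<longleftrightarrow> S (p x) (p y))"

definition rel_iso :: "('a \<Rightarrow> 'a \<Rightarrow> bool) \<Rightarrow> ('b \<Rightarrow> 'b \<Rightarrow> bool) \<Rightarrow> bool" where
  "rel_iso R S \<longleftrightarrow> (\<exists>p. rel_isomorphism R S p)"

definition vertex_transitive :: "('a \<Rightarrow> 'a \<Rightarrow> bool) \<Rightarrow> bool" where
  "vertex_transitive R \<longleftrightarrow> (\<forall>x y. \<exists>g. rel_isomorphism R R g \<and> g x = y)"

definition strict_partial_order :: "('a \<Rightarrow> 'a \<Rightarrow> bool) \<Rightarrow> bool" where
  "strict_partial_order R \<longleftrightarrow> irreflp R \<and> transp R"

end

theory Submission
  imports Defs "HOL-Library.FSet"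
begin

text \<open>
  For a set \<open>S\<close> in an abelian group \<open>G\<close>, order \<open>G \<times> \<int>\<close> by \<open>(g, n) < (g', n')\<close> iff \<open>n < n'\<close> and
  \<open>g' - g\<close> is a sum of \<open>n' - n\<close> elements of \<open>S\<close>. Translations make this order vertex-transitive,
  its covers are the pairs with \<open>n' = n + 1\<close> and \<open>g' - g \<in> S\<close>, and it lives on a set that does not
  depend on \<open>S\<close>. Here \<open>G\<close> is the group of finite sets under symmetric difference.

  A structure \<open>A\<close> is first coded as an edge-coloured complete graph whose nodes are the elements and
  the tuples of \<open>\<nat>\<close>; the colour of the edge between an element \<open>v\<close> and a tuple \<open>w\<close> for the symbol
  \<open>r\<close> records \<open>r\<close>, whether \<open>A r w\<close> holds, and the positions at which \<open>v\<close> occurs in \<open>w\<close>. The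
  generating set \<open>S\<close> has a singleton for each node, and an edge \<open>pq\<close> of colour \<open>c\<close> contributes \<open>c\<close>
  further pairs of generators with sum \<open>{p, q}\<close>. Hence \<open>({p, q}, 2)\<close> has exactly \<open>2 + 2 * c\<close>
  midpoints above the origin, whereas every point that is not of this form has at most four or
  infinitely many. The nodes are the atoms that are midpoints for two different points of this
  kind, so any isomorphism fixing the origin induces an isomorphism of the coloured graphs.
\<close>

section \<open>The group of finite sets and the order of a generating set\<close>

datatype 'q gen = Node 'q | Link 'q 'q nat

text \<open>Countability allows the points of the order to be enumerated by the naturals, and turns
  quantifiers over finite sets of generator symbols into countable unions.\<close>

instance gen :: (countable) countable
  by countable_datatype

definition sdiff :: "'a fset \<Rightarrow> 'a fset \<Rightarrow> 'a fset" where
  "sdiff F G = (F |-| G) |\<union>| (G |-| F)"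

lemma fmember_sdiff [simp]: "x |\<in>| sdiff F G \<longleftrightarrow> (x |\<in>| F) \<noteq> (x |\<in>| G)"
  by (auto simp: sdiff_def)

lemma sdiff_commute: "sdiff F G = sdiff G F"
  by (auto simp: fset_eq_iff)

lemma sdiff_assoc: "sdiff (sdiff F G) H = sdiff F (sdiff G H)"
  by (auto simp: fset_eq_iff)

lemma sdiff_left_commute: "sdiff F (sdiff G H) = sdiff G (sdiff F H)"
  by (auto simp: fset_eq_iff)

lemmas sdiff_ac = sdiff_assoc sdiff_commute sdiff_left_commute

lemma sdiff_simps [simp]:
  "sdiff F {||} = F" "sdiff {||} F = F" "sdiff F F = {||}" "sdiff F (sdiff F G) = G"
  by (auto simp: fset_eq_iff)

lemma sdiff_translate [simp]: "sdiff (sdiff F H) (sdiff G H) = sdiff F G"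
  by (auto simp: fset_eq_iff)

lemma sdiff_eq_iff: "sdiff F G = H \<longleftrightarrow> F = sdiff G H"
  by (auto simp: fset_eq_iff)

lemma fimage_sdiff: "inj h \<Longrightarrow> h |`| sdiff F G = sdiff (h |`| F) (h |`| G)"
  by (auto simp: fset_eq_iff inj_image_mem_iff sdiff_def fimage.rep_eq inj_eq)

text \<open>Every group element is its own inverse, so \<open>sdiff F s\<close> is also
  \<open>F\<close> minus \<open>s\<close>. Repeated terms are allowed.\<close>

primrec nsum :: "'a fset set \<Rightarrow> nat \<Rightarrow> 'a fset \<Rightarrow> bool" where
  "nsum S 0 F \<longleftrightarrow> F = {||}"
| "nsum S (Suc n) F \<longleftrightarrow> (\<exists>s\<in>S. nsum S n (sdiff F s))"

lemma nsum_1 [simp]: "nsum S (Suc 0) F \<longleftrightarrow> F \<in> S"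
  by (auto simp: sdiff_eq_iff)

lemma nsum_add: "nsum S m F \<Longrightarrow> nsum S n G \<Longrightarrow> nsum S (m + n) (sdiff F G)"
proof (induction m arbitrary: F)
  case (Suc m)
  then obtain s where "s \<in> S" "nsum S m (sdiff F s)" by auto
  with Suc.IH[OF this(2)] Suc.prems show ?case
    by (auto simp: sdiff_ac intro!: bexI[of _ s])
qed simp

lemma nsum_fimage:
  assumes "inj h"
  shows "nsum ((|`|) h ` S) n (h |`| F) \<longleftrightarrow> nsum S n F"
  by (induction n arbitrary: F) (simp_all add: fimage_sdiff[OF assms, symmetric])

text \<open>The integer coordinate counts the generators used. It makes the relation irreflexive
  although \<open>s + s = 0\<close> for every generator.\<close>

definition cayley_order :: "'a fset set \<Rightarrow> 'a fset \<times> int \<Rightarrow> 'a fset \<times> int \<Rightarrow> bool" where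
  "cayley_order S x y \<longleftrightarrow> snd x < snd y \<and> nsum S (nat (snd y - snd x)) (sdiff (fst x) (fst y))"

lemma strict_partial_order_cayley_order: "strict_partial_order (cayley_order S)"
proof -
  have "cayley_order S x z" if "cayley_order S x y" "cayley_order S y z" for x y z
  proof -
    have "nsum S (nat (snd y - snd x) + nat (snd z - snd y))
            (sdiff (sdiff (fst x) (fst y)) (sdiff (fst y) (fst z)))"
      using that by (intro nsum_add) (auto simp: cayley_order_def)
    moreover have "nat (snd y - snd x) + nat (snd z - snd y) = nat (snd z - snd x)"
      using that by (auto simp: cayley_order_def)
    moreover have "sdiff (sdiff (fst x) (fst y)) (sdiff (fst y) (fst z)) = sdiff (fst x) (fst z)"
      by (auto simp: fset_eq_iff)
    ultimately show ?thesis using that by (simp add: cayley_order_def)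
  qed
  then show ?thesis
    unfolding strict_partial_order_def
    by (auto intro!: irreflpI transpI simp: cayley_order_def[of _ x x for x])
qed

lemma vertex_transitive_cayley_order: "vertex_transitive (cayley_order S)"
  unfolding vertex_transitive_def
proof (intro allI)
  fix x y :: "'a fset \<times> int"
  define H where "H = sdiff (fst x) (fst y)"
  define k where "k = snd y - snd x"
  define g where "g = (\<lambda>z :: 'a fset \<times> int. (sdiff (fst z) H, snd z + k))"
  have "bij g"
    by (rule o_bij[of "\<lambda>z. (sdiff (fst z) H, snd z - k)"])
       (auto simp: g_def fun_eq_iff sdiff_ac)
  moreover have "cayley_order S u v \<longleftrightarrow> cayley_order S (g u) (g v)" for u v
    by (simp add: cayley_order_def g_def)
  moreover have "g x = y" by (simp add: g_def H_def k_def prod_eq_iff)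
  ultimately show "\<exists>g. rel_isomorphism (cayley_order S) (cayley_order S) g \<and> g x = y"
    unfolding rel_isomorphism_def by blast
qed

section \<open>Covers and midpoints\<close>

definition cover :: "('a \<Rightarrow> 'a \<Rightarrow> bool) \<Rightarrow> 'a \<Rightarrow> 'a \<Rightarrow> bool" where
  "cover R x y \<longleftrightarrow> R x y \<and> (\<nexists>z. R x z \<and> R z y)"

definition midpoints :: "('a \<Rightarrow> 'a \<Rightarrow> bool) \<Rightarrow> 'a \<Rightarrow> 'a \<Rightarrow> 'a set" where
  "midpoints R x z = {y. cover R x y \<and> cover R y z}"

text \<open>\<open>card\<close> vanishes on infinite sets, so the bounds below also demand finiteness.\<close>
definition busy :: "('a \<Rightarrow> 'a \<Rightarrow> bool) \<Rightarrow> 'a \<Rightarrow> 'a \<Rightarrow> bool" where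
  "busy R x y \<longleftrightarrow> (\<exists>z z'. z \<noteq> z' \<and> card (midpoints R x z) \<ge> 6 \<and> card (midpoints R x z') \<ge> 6 \<and>
     y \<in> midpoints R x z \<and> y \<in> midpoints R x z')"

lemma cover_rel_isomorphism:
  assumes "rel_isomorphism R R' g"
  shows "cover R' (g x) (g y) \<longleftrightarrow> cover R x y"
proof -
  have "(\<exists>z. R' (g x) z \<and> R' z (g y)) \<longleftrightarrow> (\<exists>z. R' (g x) (g z) \<and> R' (g z) (g y))"
    using assms unfolding rel_isomorphism_def by (metis bij_pointE)
  then show ?thesis using assms by (simp add: cover_def rel_isomorphism_def)
qed

lemma midpoints_rel_isomorphism:
  assumes "rel_isomorphism R R' g"
  shows "midpoints R' (g x) (g z) = g ` midpoints R x z"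
proof -
  have "y \<in> g ` midpoints R x z" if "y \<in> midpoints R' (g x) (g z)" for y
  proof -
    obtain y' where "y = g y'" using assms unfolding rel_isomorphism_def by (metis bij_pointE)
    with that show ?thesis by (simp add: midpoints_def cover_rel_isomorphism[OF assms])
  qed
  then show ?thesis by (auto simp: midpoints_def cover_rel_isomorphism[OF assms])
qed

lemma card_midpoints_rel_isomorphism:
  assumes "rel_isomorphism R R' g"
  shows "card (midpoints R' (g x) (g z)) = card (midpoints R x z)"
  using assms unfolding midpoints_rel_isomorphism[OF assms] rel_isomorphism_def
  by (intro card_image) (auto intro: inj_on_subset dest: bij_is_inj)

lemma busy_rel_isomorphism:
  assumes "rel_isomorphism R R' g"
  shows "busy R' (g x) (g y) \<longleftrightarrow> busy R x y"
proof -
  have g: "bij g" using assms by (simp add: rel_isomorphism_def)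
  let ?P = "\<lambda>z z'. z \<noteq> z' \<and> card (midpoints R' (g x) z) \<ge> 6 \<and> card (midpoints R' (g x) z') \<ge> 6 \<and>
     g y \<in> midpoints R' (g x) z \<and> g y \<in> midpoints R' (g x) z'"
  have "(\<exists>z z'. ?P z z') \<longleftrightarrow> (\<exists>z z'. ?P (g z) (g z'))"
  proof
    assume "\<exists>z z'. ?P z z'"
    then obtain z z' where "?P z z'" by blast
    moreover obtain u u' where "z = g u" "z' = g u'" using g by (metis bij_pointE)
    ultimately have "?P (g u) (g u')" by simp
    then show "\<exists>z z'. ?P (g z) (g z')" by blast
  qed blast
  then show ?thesis
    unfolding busy_def midpoints_rel_isomorphism[OF assms]
    using g by (simp add: inj_image_mem_iff[OF bij_is_inj] inj_eq[OF bij_is_inj]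
      card_image[OF inj_on_subset[OF bij_is_inj]])
qed

lemma rel_isomorphism_comp:
  "rel_isomorphism R R' g \<Longrightarrow> rel_isomorphism R' R'' h \<Longrightarrow> rel_isomorphism R R'' (h \<circ> g)"
  unfolding rel_isomorphism_def by (metis bij_comp comp_apply)

text \<open>No integer level lies strictly between consecutive ones. Across a larger gap, splitting
  one generator off the sum yields an intermediate point at level \<open>snd x + 1\<close>.\<close>

lemma cover_cayley_order:
  "cover (cayley_order S) x y \<longleftrightarrow> snd y = snd x + 1 \<and> sdiff (fst x) (fst y) \<in> S"
proof (cases "snd y = snd x + 1")
  case True
  then have "\<not> (cayley_order S x z \<and> cayley_order S z y)" for z
    by (auto simp: cayley_order_def)
  moreover have "cayley_order S x y \<longleftrightarrow> sdiff (fst x) (fst y) \<in> S"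
    using True by (simp add: cayley_order_def del: nsum.simps)
  ultimately show ?thesis using True by (auto simp: cover_def)
next
  case False
  have "\<exists>z. cayley_order S x z \<and> cayley_order S z y" if "cayley_order S x y"
  proof -
    define k where "k = nat (snd y - snd x - 1)"
    have "nat (snd y - snd x) = Suc k" and less: "snd x + 1 < snd y"
      using that False by (auto simp: cayley_order_def k_def)
    then have "nsum S (Suc k) (sdiff (fst x) (fst y))"
      using that unfolding cayley_order_def by simp
    then obtain s where "s \<in> S" "nsum S k (sdiff (sdiff (fst x) (fst y)) s)" by auto
    moreover have "nat (snd y - (snd x + 1)) = k" by (simp add: k_def)
    ultimately show ?thesis using less
      by (intro exI[of _ "(sdiff (fst x) s, snd x + 1)"])
         (auto simp: cayley_order_def sdiff_ac simp del: nsum.simps)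
  qed
  with False show ?thesis by (auto simp: cover_def)
qed

text \<open>An ordered decomposition of \<open>F\<close> into two generators is recorded by its
  first term, as the second one is forced.\<close>

definition summands :: "'a fset set \<Rightarrow> 'a fset \<Rightarrow> 'a fset set" where
  "summands S F = {s \<in> S. sdiff F s \<in> S}"

lemma midpoints_cayley_order:
  "midpoints (cayley_order S) ({||}, 0) (F, n) = (if n = 2 then (\<lambda>s. (s, 1)) ` summands S F else {})"
  by (auto simp: midpoints_def cover_cayley_order summands_def sdiff_commute)

lemma card_midpoints_cayley_order:
  "card (midpoints (cayley_order S) ({||}, 0) (F, n)) = (if n = 2 then card (summands S F) else 0)"
  by (auto simp: midpoints_cayley_order intro!: card_image inj_onI)

section \<open>Counting decompositions into two generators\<close>

text \<open>
  The links of \<open>(p, q)\<close> and of \<open>(q, p)\<close> are distinct generators, so the colour of the edge \<open>pq\<close> is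
  \<open>m p q + m q p\<close>.
\<close>
definition gens :: "('q \<Rightarrow> 'q \<Rightarrow> nat) \<Rightarrow> 'q gen fset set" where
  "gens m = {F. (\<exists>q. F = {|Node q|}) \<or> (\<exists>p q i. p \<noteq> q \<and> i < m p q \<and>
     (F = {|Link p q i|} \<or> F = {|Node p, Node q, Link p q i|}))}"

lemma gensI:
  "{|Node q|} \<in> gens m"
  "p \<noteq> q \<Longrightarrow> i < m p q \<Longrightarrow> {|Link p q i|} \<in> gens m"
  "p \<noteq> q \<Longrightarrow> i < m p q \<Longrightarrow> {|Node p, Node q, Link p q i|} \<in> gens m"
  unfolding gens_def by blast+

lemma gens_cases [consumes 1]:
  assumes "F \<in> gens m"
  obtains q where "F = {|Node q|}"
  | p q i where "p \<noteq> q" "i < m p q" "F = {|Link p q i|}"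
  | p q i where "p \<noteq> q" "i < m p q" "F = {|Node p, Node q, Link p q i|}"
  using assms unfolding gens_def by auto

text \<open>A link symbol occurs in only two generators. All the counting below rests on
  this.\<close>

lemma gens_Link:
  assumes "F \<in> gens m" "Link p q i |\<in>| F"
  shows "p \<noteq> q \<and> i < m p q \<and> (F = {|Link p q i|} \<or> F = {|Node p, Node q, Link p q i|})"
  using assms by (cases rule: gens_cases) auto

lemma gens_no_Link:
  assumes "F \<in> gens m" "\<And>p q i. Link p q i |\<notin>| F"
  obtains q where "F = {|Node q|}"
  using assms by (cases rule: gens_cases) auto

text \<open>A link in \<open>F\<close> survives from exactly one of the two summands, and that
  summand is one of the two generators containing the link: two choices of position times two
  generators.\<close>

lemma card_summands_Link:
  assumes "Link p q i |\<in>| F"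
  shows "card (summands (gens m) F) \<le> 4"
proof -
  let ?c = "{|Link p q i|}" and ?d = "{|Node p, Node q, Link p q i|}"
  have "summands (gens m) F \<subseteq> {?c, ?d, sdiff F ?c, sdiff F ?d}"
  proof
    fix s assume s: "s \<in> summands (gens m) F"
    show "s \<in> {?c, ?d, sdiff F ?c, sdiff F ?d}"
    proof (cases "Link p q i |\<in>| s")
      case True
      then show ?thesis using s gens_Link[of s] by (auto simp: summands_def)
    next
      case False
      then have "Link p q i |\<in>| sdiff F s" using assms by simp
      then have "sdiff F s = ?c \<or> sdiff F s = ?d"
        using s gens_Link[of "sdiff F s" m] unfolding summands_def by blast
      then show ?thesis by (metis insert_iff sdiff_simps(4))
    qed
  qed
  then have "card (summands (gens m) F) \<le> card {?c, ?d, sdiff F ?c, sdiff F ?d}"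
    by (intro card_mono) auto
  also have "\<dots> \<le> 4" by (auto simp: card_insert_if)
  finally show ?thesis .
qed

text \<open>The bound 4 excludes links in \<open>F\<close>, and the empty set has infinitely many
  summands. Otherwise the summands are two distinct nodes, or the two generators of a common link
  that cancels.\<close>

lemma heavy_imp_pair:
  fixes m :: "'q \<Rightarrow> 'q \<Rightarrow> nat"
  assumes "infinite (UNIV :: 'q set)" "card (summands (gens m) F) \<ge> 6"
  obtains p q where "p \<noteq> q" "F = {|Node p, Node q|}"
proof -
  have no: "Link p q i |\<notin>| F" for p q i
    using card_summands_Link[of p q i F m] assms by auto
  have "F \<noteq> {||}"
  proof
    assume "F = {||}"
    then have "range (\<lambda>q. {|Node q|}) \<subseteq> summands (gens m) F"
      by (auto simp: summands_def gensI)
    moreover have "finite (summands (gens m) F)"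
      using assms(2) by (intro card_ge_0_finite) auto
    ultimately have "finite (range (\<lambda>q :: 'q. {|Node q|}))" by (rule finite_subset)
    then have "finite (UNIV :: 'q set)" by (rule finite_imageD) (auto intro: injI)
    with assms(1) show False by simp
  qed
  have "summands (gens m) F \<noteq> {}" using assms(2) by auto
  then obtain s where s: "s \<in> gens m" "sdiff F s \<in> gens m" by (auto simp: summands_def)
  have F: "F = sdiff s (sdiff F s)" by (auto simp: fset_eq_iff)
  show thesis using s(1)
  proof (cases rule: gens_cases)
    case (1 p)
    then obtain q where q: "sdiff F s = {|Node q|}"
      using s no by (elim gens_no_Link) auto
    with 1 F \<open>F \<noteq> {||}\<close> have "p \<noteq> q" "F = {|Node p, Node q|}" by (auto simp: fset_eq_iff)
    then show thesis by (rule that)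
  next
    case (2 p q i)
    \<comment> \<open>The link lies in \<open>s\<close> but not in \<open>F\<close>, so the other
      summand contains it too; the summands differ because \<open>F\<close> is nonempty.\<close>
    then have "sdiff F s = {|Link p q i|} \<or> sdiff F s = {|Node p, Node q, Link p q i|}"
      using gens_Link[OF s(2), of p q i] no by auto
    with 2 F \<open>F \<noteq> {||}\<close> have "F = {|Node p, Node q|}" by (auto simp: fset_eq_iff)
    with 2 show thesis by (intro that)
  next
    case (3 p q i)
    then have "sdiff F s = {|Link p q i|} \<or> sdiff F s = {|Node p, Node q, Link p q i|}"
      using gens_Link[OF s(2), of p q i] no by auto
    with 3 F \<open>F \<noteq> {||}\<close> have "F = {|Node p, Node q|}" by (auto simp: fset_eq_iff)
    with 3 show thesis by (intro that)
  qed
qed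

lemma Node_mem_summands_pair:
  assumes "p \<noteq> q"
  shows "{|Node r|} \<in> summands (gens m) {|Node p, Node q|} \<longleftrightarrow> r = p \<or> r = q"
proof
  assume "{|Node r|} \<in> summands (gens m) {|Node p, Node q|}"
  then have "sdiff {|Node p, Node q|} {|Node r|} \<in> gens m" by (simp add: summands_def)
  then obtain u where "sdiff {|Node p, Node q|} {|Node r|} = {|Node u|}"
    by (rule gens_no_Link) auto
  then show "r = p \<or> r = q" using assms by (auto simp: fset_eq_iff)
next
  have "sdiff {|Node p, Node q|} {|Node p|} = {|Node q|}" "sdiff {|Node p, Node q|} {|Node q|} = {|Node p|}"
    using assms by (auto simp: fset_eq_iff)
  moreover assume "r = p \<or> r = q"
  ultimately show "{|Node r|} \<in> summands (gens m) {|Node p, Node q|}"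
    by (elim disjE) (simp_all add: summands_def gensI(1))
qed

text \<open>The link has to cancel against the other summand. The two summands are then the two
  generators of that link, since equal ones would sum to the empty set, and their sum is the pair of
  its endpoints.\<close>

lemma Link_summands_pair:
  assumes "p \<noteq> q" "s \<in> summands (gens m) {|Node p, Node q|}" "Link a b i |\<in>| s"
  shows "(a = p \<and> b = q \<or> a = q \<and> b = p) \<and> i < m a b \<and>
    (s = {|Link a b i|} \<or> s = {|Node a, Node b, Link a b i|})"
proof -
  have s: "s \<in> gens m" "sdiff {|Node p, Node q|} s \<in> gens m"
    using assms by (auto simp: summands_def)
  have 1: "a \<noteq> b \<and> i < m a b \<and> (s = {|Link a b i|} \<or> s = {|Node a, Node b, Link a b i|})"
    using gens_Link[OF s(1)] assms by blast
  have 2: "sdiff {|Node p, Node q|} s = {|Link a b i|} \<or>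
      sdiff {|Node p, Node q|} s = {|Node a, Node b, Link a b i|}"
    using gens_Link[OF s(2), of a b i] assms by auto
  have "{|Node p, Node q|} = sdiff (sdiff {|Node p, Node q|} s) s"
    by (auto simp: fset_eq_iff)
  moreover have "sdiff {|Link a b i|} {|Node a, Node b, Link a b i|} = {|Node a, Node b|}"
      "sdiff {|Node a, Node b, Link a b i|} {|Link a b i|} = {|Node a, Node b|}"
    by (auto simp: fset_eq_iff)
  ultimately have "{|Node p, Node q|} = ({||} :: 'a gen fset) \<or> {|Node p, Node q|} = {|Node a, Node b|}"
    using 1 2 by (metis sdiff_simps(3))
  then have "{|Node p, Node q|} = {|Node a, Node b|}" by auto
  then have "a = p \<and> b = q \<or> a = q \<and> b = p"
    using assms(1) by (auto simp: fdoubleton_eq_iff)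
  with 1 show ?thesis by blast
qed

text \<open>The two nodes give two summands. Each link in either direction gives two more, one for
  each order of its two generators.\<close>

lemma card_summands_pair:
  assumes "p \<noteq> q"
  shows "card (summands (gens m) {|Node p, Node q|}) = 2 + 2 * (m p q + m q p)"
proof -
  \<comment> \<open>\<open>C\<close> collects the bare links and \<open>D\<close> the links together
    with their endpoints; adding the pair exchanges the two families.\<close>
  define C where "C = (\<lambda>a b. (\<lambda>i. {|Link a b i :: 'a gen|}) ` {..<m a b})"
  define D where "D = (\<lambda>a b. (\<lambda>i. {|Node a, Node b, Link a b i :: 'a gen|}) ` {..<m a b})"
  have CD: "card (C a b) = m a b" "card (D a b) = m a b" "finite (C a b)" "finite (D a b)" for a b
    by (auto simp: C_def D_def fset_eq_iff intro!: card_image[THEN trans] inj_onI)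
  have "summands (gens m) {|Node p, Node q|} =
      {{|Node p|}, {|Node q|}} \<union> (C p q \<union> C q p \<union> (D p q \<union> D q p))" (is "?l = ?r")
  proof
    show "?l \<subseteq> ?r"
    proof
      fix s assume s: "s \<in> ?l"
      then have "s \<in> gens m" by (simp add: summands_def)
      then show "s \<in> ?r"
      proof (cases rule: gens_cases)
        case (1 r)
        with s assms show ?thesis by (auto simp: Node_mem_summands_pair)
      qed (use Link_summands_pair[OF assms s] in \<open>fastforce simp: C_def D_def\<close>)+
    qed
    have "{|Link a b i|} \<in> ?l \<and> {|Node a, Node b, Link a b i|} \<in> ?l"
      if "{|Node p, Node q|} = {|Node a, Node b|}" "a \<noteq> b" "i < m a b" for a b i
    proof -
      have "sdiff {|Node p, Node q|} {|Link a b i|} = {|Node a, Node b, Link a b i|}"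
        "sdiff {|Node p, Node q|} {|Node a, Node b, Link a b i|} = {|Link a b i|}"
        unfolding that(1) by (auto simp: fset_eq_iff)
      with that show ?thesis by (simp add: summands_def gensI)
    qed
    from this[of p q] this[of q p] show "?r \<subseteq> ?l"
      using assms by (auto simp: C_def D_def Node_mem_summands_pair finsert_commute)
  qed
  moreover have "C p q \<inter> C q p = {}" "D p q \<inter> D q p = {}"
      "(C p q \<union> C q p) \<inter> (D p q \<union> D q p) = {}"
      "{{|Node p|}, {|Node q|}} \<inter> (C p q \<union> C q p \<union> (D p q \<union> D q p)) = {}"
    using assms by (auto simp: C_def D_def fset_eq_iff)
  moreover have "{|Node p|} \<noteq> {|Node q|}" using assms by auto
  ultimately show ?thesis by (simp add: card_Un_disjoint CD)
qed


section \<open>Recovering the coloured graph from the order\<close>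

context
  fixes m :: "'q \<Rightarrow> 'q \<Rightarrow> nat"
  assumes infinite_nodes: "infinite (UNIV :: 'q set)"
    and colour_ge_2: "\<forall>p q. p \<noteq> q \<longrightarrow> m p q + m q p \<ge> 2"
begin

text \<open>Colours of at least 2 lift every pair to \<open>2 + 2 * 2 = 6\<close> midpoints, beyond
  the bound 4 for points involving links.\<close>

lemma heavy_cayley_order_iff:
  "card (midpoints (cayley_order (gens m)) ({||}, 0) z) \<ge> 6 \<longleftrightarrow>
    (\<exists>p q. p \<noteq> q \<and> z = ({|Node p, Node q|}, 2))"
proof (cases z)
  case (Pair F n)
  have "6 \<le> card (summands (gens m) F) \<longleftrightarrow> (\<exists>p q. p \<noteq> q \<and> F = {|Node p, Node q|})"
  proof
    assume "6 \<le> card (summands (gens m) F)"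
    then show "\<exists>p q. p \<noteq> q \<and> F = {|Node p, Node q|}"
      by (rule heavy_imp_pair[OF infinite_nodes]) blast
  next
    assume "\<exists>p q. p \<noteq> q \<and> F = {|Node p, Node q|}"
    then obtain p q where "p \<noteq> q" "F = {|Node p, Node q|}" by blast
    with colour_ge_2[rule_format, of p q] show "6 \<le> card (summands (gens m) F)"
      by (simp add: card_summands_pair)
  qed
  with Pair show ?thesis by (auto simp: card_midpoints_cayley_order)
qed

lemma Node_mem_midpoints_pair:
  assumes "p \<noteq> q"
  shows "({|Node r|}, k) \<in> midpoints (cayley_order (gens m)) ({||}, 0) ({|Node p, Node q|}, 2) \<longleftrightarrow>
    k = 1 \<and> (r = p \<or> r = q)"
  using Node_mem_summands_pair[OF assms, of r m]
  by (auto simp: midpoints_cayley_order)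

text \<open>A midpoint containing a link determines its pair, whereas a node is a midpoint for its
  pair with any other node.\<close>

lemma busy_cayley_order_iff:
  "busy (cayley_order (gens m)) ({||}, 0) x \<longleftrightarrow> (\<exists>q. x = ({|Node q|}, 1))"
proof
  assume "busy (cayley_order (gens m)) ({||}, 0) x"
  then obtain p q p' q' where pq: "p \<noteq> q" "p' \<noteq> q'"
      "{|Node p, Node q|} \<noteq> {|Node p', Node q'|}"
      "x \<in> midpoints (cayley_order (gens m)) ({||}, 0) ({|Node p, Node q|}, 2)"
      "x \<in> midpoints (cayley_order (gens m)) ({||}, 0) ({|Node p', Node q'|}, 2)"
    unfolding busy_def heavy_cayley_order_iff by blast
  then obtain s where s: "x = (s, 1)" "s \<in> summands (gens m) {|Node p, Node q|}"
      "s \<in> summands (gens m) {|Node p', Node q'|}"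
    by (auto simp: midpoints_cayley_order)
  have "Link a b i |\<notin>| s" for a b i
  proof
    assume "Link a b i |\<in>| s"
    from Link_summands_pair[OF pq(1) s(2) this] Link_summands_pair[OF pq(2) s(3) this] pq(3)
    show False by (auto simp: finsert_commute)
  qed
  moreover have "s \<in> gens m" using s by (simp add: summands_def)
  ultimately obtain q where "s = {|Node q|}" using gens_no_Link by blast
  with s show "\<exists>q. x = ({|Node q|}, 1)" by blast
next
  assume "\<exists>q. x = ({|Node q|}, 1)"
  then obtain q where q: "x = ({|Node q|}, 1)" by blast
  \<comment> \<open>Two further nodes \<open>p\<close> and \<open>r\<close> provide two different
    pairs through \<open>q\<close>.\<close>
  obtain p where p: "p \<noteq> q"
    using ex_new_if_finite[OF infinite_nodes, of "{q}"] by auto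
  obtain r where r: "r \<noteq> q" "r \<noteq> p"
    using ex_new_if_finite[OF infinite_nodes, of "{q, p}"] by auto
  show "busy (cayley_order (gens m)) ({||}, 0) x"
    unfolding busy_def heavy_cayley_order_iff q
  proof (intro exI conjI)
    show "({|Node q, Node p|}, 2) \<noteq> ({|Node q, Node r|}, 2 :: int)"
      using p r by (auto simp: fdoubleton_eq_iff)
  qed (use p r in \<open>auto simp: Node_mem_midpoints_pair\<close>)
qed

end

text \<open>After normalisation to fix the origin, the isomorphism permutes the busy points, which
  are the nodes; this permutation is \<open>h\<close>. Midpoint counts over pairs then return the
  colours.\<close>

lemma rel_iso_imp_colour_iso:
  fixes m m' :: "'q \<Rightarrow> 'q \<Rightarrow> nat"
  assumes inf: "infinite (UNIV :: 'q set)"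
    and m: "\<forall>p q. p \<noteq> q \<longrightarrow> m p q + m q p \<ge> 2"
    and m': "\<forall>p q. p \<noteq> q \<longrightarrow> m' p q + m' q p \<ge> 2"
    and "rel_iso (cayley_order (gens m)) (cayley_order (gens m'))"
  obtains h where "bij h" "\<And>p q. p \<noteq> q \<Longrightarrow> m p q + m q p = m' (h p) (h q) + m' (h q) (h p)"
proof -
  let ?R = "cayley_order (gens m)" and ?R' = "cayley_order (gens m')"
  let ?o = "({||}, 0) :: 'q gen fset \<times> int"
  obtain g0 where g0: "rel_isomorphism ?R ?R' g0" using assms(4) by (auto simp: rel_iso_def)
  \<comment> \<open>Vertex-transitivity of the target moves the image of the origin back to the
    origin.\<close>
  obtain t where t: "rel_isomorphism ?R' ?R' t" "t (g0 ?o) = ?o"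
    using vertex_transitive_cayley_order[of "gens m'"] unfolding vertex_transitive_def by blast
  define g where "g = t \<circ> g0"
  have g: "rel_isomorphism ?R ?R' g"
    unfolding g_def using g0 t(1) by (rule rel_isomorphism_comp)
  have go: "g ?o = ?o" using t by (simp add: g_def)
  have bij: "bij g" using g by (simp add: rel_isomorphism_def)
  have busy: "(\<exists>q. g x = ({|Node q|}, 1)) \<longleftrightarrow> (\<exists>q. x = ({|Node q|}, 1))" for x
    using busy_rel_isomorphism[OF g, of ?o x]
    by (simp only: go busy_cayley_order_iff[OF inf m] busy_cayley_order_iff[OF inf m'])
  then have "\<forall>q. \<exists>r. g ({|Node q|}, 1) = ({|Node r|}, 1)" by blast
  then obtain h where h: "g ({|Node q|}, 1) = ({|Node (h q)|}, 1)" for q by metis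
  have "bij h"
  proof (rule bijI)
    show "inj h"
    proof (rule injI)
      fix x y assume "h x = h y"
      then have "g ({|Node x|}, 1) = g ({|Node y|}, 1)" by (simp add: h)
      then show "x = y" using bij by (auto dest: bij_is_inj injD)
    qed
    have "\<exists>p. h p = q" for q
    proof -
      obtain x where x: "g x = ({|Node q|}, 1)" using bij by (metis bij_pointE)
      then obtain p where "x = ({|Node p|}, 1)" using busy by blast
      with x h[of p] show ?thesis by auto
    qed
    then show "surj h" by (metis surjI)
  qed
  moreover have "m p q + m q p = m' (h p) (h q) + m' (h q) (h p)" if "p \<noteq> q" for p q
  proof -
    let ?z = "({|Node p, Node q|}, 2) :: 'q gen fset \<times> int"
    have hpq: "h p \<noteq> h q" using \<open>bij h\<close> that by (metis bij_is_inj injD)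
    have "card (midpoints ?R ?o ?z) \<ge> 6"
      using that heavy_cayley_order_iff[OF inf m] by blast
    then have "card (midpoints ?R' ?o (g ?z)) \<ge> 6"
      using card_midpoints_rel_isomorphism[OF g, of ?o ?z] by (simp add: go)
    then obtain p' q' where pq': "p' \<noteq> q'" "g ?z = ({|Node p', Node q'|}, 2)"
      using heavy_cayley_order_iff[OF inf m'] by blast
    \<comment> \<open>The images of both nodes are midpoints for the image of their pair, which
      identifies that image as the pair of \<open>h p\<close> and \<open>h q\<close>.\<close>
    have "({|Node (h r)|}, 1) \<in> midpoints ?R' ?o (g ?z)" if "r = p \<or> r = q" for r
    proof -
      have "({|Node r|}, 1) \<in> midpoints ?R ?o ?z"
        using that Node_mem_midpoints_pair[OF inf m \<open>p \<noteq> q\<close>, of r 1] by simp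
      then have "g ({|Node r|}, 1) \<in> midpoints ?R' (g ?o) (g ?z)"
        unfolding midpoints_rel_isomorphism[OF g] by (rule imageI)
      then show ?thesis by (simp only: h go)
    qed
    then have "h p = p' \<or> h p = q'" "h q = p' \<or> h q = q'"
      unfolding pq'(2) using Node_mem_midpoints_pair[OF inf m' pq'(1)] by blast+
    then have "g ?z = ({|Node (h p), Node (h q)|}, 2)"
      using pq' hpq by (auto simp: finsert_commute)
    then have "card (midpoints ?R' ?o ({|Node (h p), Node (h q)|}, 2)) = card (midpoints ?R ?o ?z)"
      using card_midpoints_rel_isomorphism[OF g, of ?o ?z] by (simp add: go)
    then show ?thesis
      using that hpq by (simp add: card_midpoints_cayley_order card_summands_pair)
  qed
  ultimately show thesis by (rule that)
qed

lemma gens_fimage: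
  assumes "bij h" and m: "\<And>p q. m' (h p) (h q) = m p q"
  shows "gens m' = (|`|) (map_gen h) ` gens m"
proof -
  have inj: "h p = h q \<longleftrightarrow> p = q" for p q using assms(1) by (meson bij_is_inj injD)
  have surj: "\<exists>p'. p = h p'" for p using assms(1) by (metis bij_pointE)
  show ?thesis
  proof (intro equalityI subsetI)
    fix F assume "F \<in> gens m'"
    then show "F \<in> (|`|) (map_gen h) ` gens m"
    proof (cases rule: gens_cases)
      case (1 q)
      obtain q' where "q = h q'" using surj by blast
      with 1 have "F = map_gen h |`| {|Node q'|}"
        "{|Node q'|} \<in> gens m" by (auto intro!: gensI simp: m)
      then show ?thesis by blast
    next
      case (2 p q i)
      obtain p' q' where "p = h p'" "q = h q'" using surj by blast
      with 2 have "F = map_gen h |`| {|Link p' q' i|}"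
        "{|Link p' q' i|} \<in> gens m" by (auto intro!: gensI simp: m)
      then show ?thesis by blast
    next
      case (3 p q i)
      obtain p' q' where "p = h p'" "q = h q'" using surj by blast
      with 3 have "F = map_gen h |`| {|Node p', Node q', Link p' q' i|}"
        "{|Node p', Node q', Link p' q' i|} \<in> gens m" by (auto intro!: gensI simp: m)
      then show ?thesis by blast
    qed
  next
    fix F assume "F \<in> (|`|) (map_gen h) ` gens m"
    then obtain G where "G \<in> gens m" "F = map_gen h |`| G" by blast
    then show "F \<in> gens m'"
      by (cases rule: gens_cases) (auto intro!: gensI simp: m inj)
  qed
qed

text \<open>Relabelling symbols along \<open>h\<close> is a group automorphism carrying one
  generating set onto the other, and levels stay fixed. Here \<open>m\<close> has to be preserved on
  ordered pairs, not just in the sums \<open>m p q + m q p\<close>.\<close>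

lemma colour_iso_imp_rel_iso:
  assumes "bij h" and "\<And>p q. m' (h p) (h q) = m p q"
  shows "rel_iso (cayley_order (gens m)) (cayley_order (gens m'))"
proof -
  let ?g = "map_prod ((|`|) (map_gen h)) (\<lambda>n :: int. n)"
  have "inj (map_gen h)" using assms(1) by (simp add: bij_is_inj gen.inj_map)
  moreover have "bij ?g"
  proof (rule o_bij)
    have h: "inv h \<circ> h = id" "h \<circ> inv h = id"
      using assms(1) by (auto simp: bij_is_inj bij_is_surj surj_iff[symmetric])
    show "map_prod ((|`|) (map_gen (inv h))) (\<lambda>n. n) \<circ> ?g = id"
        "?g \<circ> map_prod ((|`|) (map_gen (inv h))) (\<lambda>n. n) = id"
      by (auto simp: fun_eq_iff fset.map_comp gen.map_comp comp_def[of "map_gen _"] h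
        gen.map_id0 fset.map_ident)
  qed
  ultimately show ?thesis
    unfolding rel_iso_def rel_isomorphism_def gens_fimage[where m = m and m' = m', OF assms]
    by (intro exI[of _ ?g])
       (auto simp: cayley_order_def nsum_fimage fimage_sdiff[symmetric])
qed

section \<open>Coding structures as coloured graphs\<close>

type_synonym node = "nat + nat \<times> nat list"

text \<open>False unless \<open>k\<close> codes a symbol of \<open>L\<close> whose arity is the length of \<open>w\<close>.\<close>
definition holds :: "'r set \<Rightarrow> ('r \<Rightarrow> nat) \<Rightarrow> ('r \<Rightarrow> nat list \<Rightarrow> bool) \<Rightarrow> nat \<Rightarrow> nat list \<Rightarrow> bool" where
  "holds L ar A k w \<longleftrightarrow> (\<exists>r\<in>L. to_nat_on L r = k \<and> length w = ar r \<and> A r w)"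

text \<open>Summed over both directions, the colours are 2 between elements, 4 between tuples and at
  least 5 between an element and a tuple, so they distinguish the kinds of edges. Subtracting 5 from
  a mixed colour allows \<open>to_nat\<close> to be decoded.\<close>

fun colour :: "'r set \<Rightarrow> ('r \<Rightarrow> nat) \<Rightarrow> ('r \<Rightarrow> nat list \<Rightarrow> bool) \<Rightarrow> node \<Rightarrow> node \<Rightarrow> nat" where
  "colour L ar A (Inl u) (Inl v) = 1"
| "colour L ar A (Inr a) (Inr b) = 2"
| "colour L ar A (Inr a) (Inl v) = 0"
| "colour L ar A (Inl v) (Inr (k, w)) = 5 + to_nat (k, holds L ar A k w, map (\<lambda>u. u = v) w)"

lemma colour_sum_ge_2: "colour L ar A p q + colour L ar A q p \<ge> 2"
  by (cases p; cases q) auto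

lemma structure_iso_imp_colour_iso:
  assumes "structure_iso L ar A B"
  obtains h where "bij h" "\<And>p q. colour L ar B (h p) (h q) = colour L ar A p q"
proof -
  obtain p where p: "bij p"
      "\<And>r xs. r \<in> L \<Longrightarrow> length xs = ar r \<Longrightarrow> A r xs \<longleftrightarrow> B r (map p xs)"
    using assms unfolding structure_iso_def by blast
  define h where "h = map_sum p (map_prod (\<lambda>k :: nat. k) (map p))"
  have "bij h"
  proof (rule o_bij)
    have ip: "inv p (p v) = v" "p (inv p v) = v" for v
      using p(1) by (simp_all add: bij_is_inj bij_is_surj surj_f_inv_f)
    have "map_sum (inv p) (map_prod (\<lambda>k. k) (map (inv p))) (h x) = x"
        "h (map_sum (inv p) (map_prod (\<lambda>k. k) (map (inv p))) x) = x" for x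
      by (cases x; auto simp: h_def ip comp_def)+
    then show "map_sum (inv p) (map_prod (\<lambda>k. k) (map (inv p))) \<circ> h = id"
        "h \<circ> map_sum (inv p) (map_prod (\<lambda>k. k) (map (inv p))) = id"
      by (simp_all add: fun_eq_iff)
  qed
  moreover have "holds L ar B k (map p w) \<longleftrightarrow> holds L ar A k w" for k w
    using p(2) unfolding holds_def by auto
  moreover have "p u = p v \<longleftrightarrow> u = v" for u v using p(1) by (meson bij_is_inj injD)
  ultimately have "colour L ar B (h x) (h y) = colour L ar A x y" for x y
    by (cases "(L, ar, A, x, y)" rule: colour.cases) (auto simp: h_def comp_def)
  with \<open>bij h\<close> show thesis by (rule that)
qed

text \<open>Colour 2 occurs only between elements, so \<open>h\<close> maps elements to elements and
  induces \<open>p\<close>. The mixed colours then show that a tuple \<open>w\<close> for the symbol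
  coded by \<open>k\<close> goes to \<open>map p w\<close> for the same symbol, with the same truth
  value.\<close>

lemma colour_iso_imp_structure_iso:
  fixes L :: "'r set"
  assumes L: "countable L" and h: "bij h"
    and col: "\<And>p q. p \<noteq> q \<Longrightarrow> colour L ar A p q + colour L ar A q p =
      colour L ar B (h p) (h q) + colour L ar B (h q) (h p)"
  shows "structure_iso L ar A B"
proof -
  have inj: "h x = h y \<longleftrightarrow> x = y" for x y using h by (meson bij_is_inj injD)
  have two: "x \<in> range Inl" if "colour L ar C x y + colour L ar C y x = 2" for C x y
    using that by (cases "(L, ar, C, x, y)" rule: colour.cases) auto
  have Inl: "h x \<in> range Inl \<longleftrightarrow> x \<in> range Inl" for x
  proof
    assume "x \<in> range Inl"
    then obtain v where "x = Inl v" by blast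
    then show "h x \<in> range Inl"
      \<comment> \<open>\<open>Suc v\<close> is merely a second element, giving an edge of colour 2
        at \<open>x\<close>.\<close>
      using col[of x "Inl (Suc v)"] two[of B "h x" "h (Inl (Suc v))"] by simp
  next
    assume "h x \<in> range Inl"
    then obtain v where v: "h x = Inl v" by blast
    obtain y where y: "h y = Inl (Suc v)" using h by (metis bij_pointE)
    then have "x \<noteq> y" using v by auto
    then show "x \<in> range Inl" using col[of x y] two[of A x y] v y by simp
  qed
  then have "\<forall>v. \<exists>u. h (Inl v) = Inl u" by blast
  then obtain p where p: "h (Inl v) = Inl (p v)" for v by metis
  have "bij p"
  proof (rule bijI)
    show "inj p" using inj p by (metis injI Inl_inject)
    show "surj p"
    proof (rule surjI)
      fix u
      obtain x where x: "h x = Inl u" using h by (metis bij_pointE)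
      then obtain v where "x = Inl v" using Inl by blast
      then show "p (projl (inv h (Inl u))) = u" using x p h by (metis bij_inv_eq_iff sum.sel(1))
    qed
  qed
  moreover have "A r w \<longleftrightarrow> B r (map p w)" if r: "r \<in> L" "length w = ar r" for r w
  proof -
    define k where "k = to_nat_on L r"
    have "h (Inr (k, w)) \<notin> range Inl" using Inl by blast
    then obtain k' w' where hw: "h (Inr (k, w)) = Inr (k', w')" by (cases "h (Inr (k, w))") auto
    have "to_nat (k, holds L ar A k w, map (\<lambda>u. u = v) w) =
        to_nat (k', holds L ar B k' w', map (\<lambda>u. u = p v) w')" for v
      using col[of "Inl v" "Inr (k, w)"] by (simp add: p hw del: to_nat_split)
    then have tuple: "(k, holds L ar A k w, map (\<lambda>u. u = v) w) =
        (k', holds L ar B k' w', map (\<lambda>u. u = p v) w')" for v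
      by (rule to_nat_split[THEN iffD1])
    have eq: "k' = k" "holds L ar A k w \<longleftrightarrow> holds L ar B k' w'"
      using tuple[of 0] unfolding prod.inject by (elim conjE, simp)+
    have pos: "map (\<lambda>u. u = v) w = map (\<lambda>u. u = p v) w'" for v
      using tuple[of v] by simp
    have "w' = map p w"
    proof (rule nth_equalityI)
      show len: "length w' = length (map p w)" using pos[THEN arg_cong[of _ _ length]] by simp
      \<comment> \<open>Position \<open>i\<close> is marked in the pattern of the element
        \<open>w ! i\<close>, hence also in that of its image.\<close>
      fix i assume "i < length w'"
      then show "w' ! i = map p w ! i"
        using pos[of "w ! i", THEN arg_cong[of _ _ "\<lambda>l. l ! i"]] len by simp
    qed
    moreover have "holds L ar C k u \<longleftrightarrow> C r u" if "length u = ar r" for C u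
      using r(1) that inj_on_to_nat_on[OF L] by (auto simp: holds_def k_def dest: inj_onD)
    ultimately show ?thesis using eq r(2) by simp
  qed
  ultimately show ?thesis unfolding structure_iso_def by blast
qed

section \<open>Transport along a bijection\<close>

lemma rel_isomorphism_comp_bij:
  assumes "bij b" "rel_isomorphism R R' g"
  shows "rel_isomorphism (\<lambda>x y. R (b x) (b y)) (\<lambda>x y. R' (b x) (b y)) (inv b \<circ> g \<circ> b)"
  using assms
  by (auto simp: rel_isomorphism_def bij_comp bij_imp_bij_inv bij_is_surj surj_f_inv_f)

lemma rel_iso_comp_bij:
  assumes "bij b"
  shows "rel_iso (\<lambda>x y. R (b x) (b y)) (\<lambda>x y. R' (b x) (b y)) \<longleftrightarrow> rel_iso R R'"
proof
  assume "rel_iso (\<lambda>x y. R (b x) (b y)) (\<lambda>x y. R' (b x) (b y))"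
  then obtain g where "rel_isomorphism (\<lambda>x y. R (b x) (b y)) (\<lambda>x y. R' (b x) (b y)) g"
    by (auto simp: rel_iso_def)
  \<comment> \<open>Transporting once more, along \<open>inv b\<close>, undoes the first
    transport.\<close>
  from rel_isomorphism_comp_bij[OF bij_imp_bij_inv[OF assms] this] show "rel_iso R R'"
    using assms by (auto simp: rel_iso_def bij_is_surj surj_f_inv_f)
next
  assume "rel_iso R R'"
  then show "rel_iso (\<lambda>x y. R (b x) (b y)) (\<lambda>x y. R' (b x) (b y))"
    using rel_isomorphism_comp_bij[OF assms] unfolding rel_iso_def by blast
qed

lemma strict_partial_order_comp:
  "strict_partial_order R \<Longrightarrow> strict_partial_order (\<lambda>x y. R (b x) (b y))"
  unfolding strict_partial_order_def irreflp_def transp_def by blast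

lemma vertex_transitive_comp_bij:
  assumes "bij b" "vertex_transitive R"
  shows "vertex_transitive (\<lambda>x y. R (b x) (b y))"
  unfolding vertex_transitive_def
proof (intro allI)
  fix x y
  obtain g where g: "rel_isomorphism R R g" "g (b x) = b y"
    using assms(2) unfolding vertex_transitive_def by blast
  have "(inv b \<circ> g \<circ> b) x = y"
    using g(2) assms(1) by (simp add: bij_is_inj inv_f_f)
  with rel_isomorphism_comp_bij[OF assms(1) g(1)]
  show "\<exists>g. rel_isomorphism (\<lambda>x y. R (b x) (b y)) (\<lambda>x y. R (b x) (b y)) g \<and> g x = y"
    by blast
qed

section \<open>Measurability of the coding\<close>

lemma measurable_holds:
  assumes "countable L"
  shows "Measurable.pred (Mod_space L ar) (\<lambda>A. holds L ar A k w)"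
proof -
  have "Measurable.pred (Mod_space L ar) (\<lambda>A. A r w)" if "r \<in> L" "length w = ar r" for r
    unfolding Mod_space_def using that
    by (intro measurable_compose[OF measurable_component_singleton[of r L]]
        measurable_component_singleton) auto
  \<comment> \<open>Only lists of the right length are coordinates of the product; when a guard
    fails, the predicate is constantly false.\<close>
  then have "Measurable.pred (Mod_space L ar) (\<lambda>A. to_nat_on L r = k \<and> length w = ar r \<and> A r w)"
    if "r \<in> L" for r
    using that by (cases "to_nat_on L r = k \<and> length w = ar r") simp_all
  then show ?thesis
    unfolding holds_def pred_def by (intro sets.sets_Collect_countable_Ex' assms)
qed

lemma measurable_colour:
  assumes "countable L"
  shows "(\<lambda>A. colour L ar A p q) \<in> Mod_space L ar \<rightarrow>\<^sub>M count_space UNIV"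
proof -
  have "(\<lambda>A. 5 + to_nat (k, holds L ar A k w, map (\<lambda>u. u = v) w)) \<in> Mod_space L ar \<rightarrow>\<^sub>M count_space UNIV"
    for k w v
    by (rule measurable_compose[OF measurable_holds[OF assms]]) simp
  then show ?thesis by (cases p; cases q) auto
qed

text \<open>For fixed points, the relation is built from the conditions \<open>i < m A p q\<close>
  by countable Boolean operations: the quantifiers over nodes, indices and finite sets all range
  over countable types.\<close>

lemma measurable_cayley_order:
  assumes "\<And>p q. (\<lambda>A. m A p q) \<in> M \<rightarrow>\<^sub>M count_space UNIV"
  shows "Measurable.pred M (\<lambda>A. cayley_order (gens (m A :: 'q :: countable \<Rightarrow> _)) x y)"
proof -
  have "Measurable.pred M (\<lambda>A. i < m A p q)" for i p q
    by (rule measurable_compose[OF assms]) simp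
  then have gens: "Measurable.pred M (\<lambda>A. F \<in> gens (m A))" for F
    unfolding gens_def mem_Collect_eq
    by (intro pred_intros_logic(3,5) pred_intros_countable(2)) simp_all
  have "Measurable.pred M (\<lambda>A. nsum (gens (m A)) n F)" for n F
  proof (induction n arbitrary: F)
    case (Suc n)
    then show ?case
      unfolding nsum.simps Bex_def by (intro pred_intros_logic(3) pred_intros_countable(2) gens)
  qed simp
  then show ?thesis
    unfolding cayley_order_def by (intro pred_intros_logic(3)) simp_all
qed

theorem theorem2p3:
  fixes L :: "'r set" and ar :: "'r \<Rightarrow> nat"
  assumes "countable L"
  shows "\<exists>f \<in> Mod_space L ar \<rightarrow>\<^sub>M binrel_space.
           (\<forall>A \<in> space (Mod_space L ar). strict_partial_order (f A) \<and> vertex_transitive (f A)) \<and>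
           (\<forall>A \<in> space (Mod_space L ar). \<forall>B \<in> space (Mod_space L ar).
              structure_iso L ar A B \<longleftrightarrow> rel_iso (f A) (f B))"
proof -
  \<comment> \<open>One enumeration serves all structures, because the underlying set does not
    depend on \<open>A\<close>; the integer factor makes it infinite.\<close>
  define b where "b = (from_nat_into UNIV :: nat \<Rightarrow> node gen fset \<times> int)"
  have b: "bij b" unfolding b_def
    by (rule bij_betw_from_nat_into) (auto simp: finite_prod infinite_UNIV_int)
  define P where "P A = cayley_order (gens (colour L ar A))" for A
  define f where "f A = (\<lambda>x y. P A (b x) (b y))" for A
  have inf: "infinite (UNIV :: node set)" by simp
  have "structure_iso L ar A B \<longleftrightarrow> rel_iso (P A) (P B)" for A B
  proof
    assume "structure_iso L ar A B"
    then show "rel_iso (P A) (P B)"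
      unfolding P_def by (elim structure_iso_imp_colour_iso) (rule colour_iso_imp_rel_iso)
  next
    assume "rel_iso (P A) (P B)"
    then show "structure_iso L ar A B"
      unfolding P_def
      \<comment> \<open>The edge colours of the two graphs correspond under the resulting
        \<open>h\<close>, and decoding them gives the isomorphism of structures.\<close>
      by (elim rel_iso_imp_colour_iso[OF inf, rotated 2])
         (auto simp: colour_sum_ge_2 intro: colour_iso_imp_structure_iso[OF assms])
  qed
  moreover have "strict_partial_order (f A)" for A
    unfolding f_def P_def by (rule strict_partial_order_comp[OF strict_partial_order_cayley_order])
  moreover have "vertex_transitive (f A)" for A
    unfolding f_def P_def by (rule vertex_transitive_comp_bij[OF b vertex_transitive_cayley_order])
  moreover have "f \<in> Mod_space L ar \<rightarrow>\<^sub>M binrel_space"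
    unfolding f_def P_def binrel_space_def
    by (intro measurable_PiM_single' measurable_cayley_order measurable_colour assms)
       (auto simp: space_PiM)
  ultimately show ?thesis
    by (intro bexI[of _ f]) (auto simp: f_def rel_iso_comp_bij[OF b])
qed

end
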